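(* (1) For any $\lambda\in[0,1)$: $\omega\text{-}\mathrm{RL}\not\subseteq\mathbb{L}^{>\lambda}(\mathrm{QBA}|\mathrm{D})$. (2) For any $\lambda\in[0,1)$: $\omega\text{-}\mathrm{CFL}\setminus\omega\text{-}\mathrm{RL}\not\subseteq\mathbb{L}^{>\lambda}(\mathrm{QBA}|\mathrm{D})$. (3) $\mathbb{L}^{=1}(\mathrm{QBA}|\mathrm{D})\not\subseteq\omega\text{-}\mathrm{RL}$.
   Context: A quantum automaton is a tuple $\mathcal{A}=(\mathcal{H},|s_0\rangle,\Sigma,\{U_\sigma:\sigma\in\Sigma\},F)$ where $\mathcal{H}$ is a finite-dimensional complex Hilbert space, $|s_0\rangle$ a unit vector, $\Sigma$ a finite alphabet, each $U_\sigma$ unitary, and $F$ a subspace. For $w=\sigma_1\sigma_2\cdots\in\Sigma^\omega$, a unit vector $|\psi\rangle\in F$ and checkpoints $0\le n_1<n_2<\cdots$, the disturbing run is $|s_0\rangle$ and for $n\ge1$: $|s_n\rangle=U_{\sigma_n}|\psi\rangle$ if $n-1=n_i$ for some $i$, else $|s_n\rangle=U_{\sigma_n}|s_{n-1}\rangle$; $f^{\mathrm{D}}_{\mathcal{A}}(w)=\sup_{|\psi\rangle}\sup_{\{n_i\}}\inf_{i\ge1}|\langle\psi|s_{n_i}\rangle|^2$. $\mathcal{L}^{>\lambda}(\mathcal{A}|\mathrm{D})=\{w:f^{\mathrm{D}}_{\mathcal{A}}(w)>\lambda\}$, $\mathcal{L}^{=1}(\mathcal{A}|\mathrm{D})=\{w:f^{\mathrm{D}}_{\mathcal{A}}(w)=1\}$;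 $\mathbb{L}^{>\lambda}(\mathrm{QBA}|\mathrm{D})$, $\mathbb{L}^{=1}(\mathrm{QBA}|\mathrm{D})$ are the classes of all such languages over all quantum automata. $\omega\text{-}\mathrm{RL}$ (resp. $\omega\text{-}\mathrm{CFL}$) is the class of all $\omega$-languages $\bigcup_{i=1}^n U_iV_i^\omega$ with $U_i,V_i$ regular (resp. context-free) languages of finite words, $V^\omega$ being the set of infinite concatenations of nonempty words from $V$. *)

theory Defs
  imports "Jordan_Normal_Form.Schur_Decomposition" "HOL-Library.Omega_Words_Fun"
begin

section \<open>Finite words: regular and context-free languages over an alphabet\<close>

text \<open>A language of finite words over the finite alphabet Sigma is regular iff it is
accepted by a nondeterministic finite automaton (states: a finite set of naturals).\<close>

definition nfa_accepts ::
  "nat set \<Rightarrow> nat \<Rightarrow> (nat \<times> 'a \<times> nat) set \<Rightarrow> nat set \<Rightarrow> 'a list \<Rightarrow> bool" where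
  "nfa_accepts Q q0 \<delta> Fin w \<longleftrightarrow>
     (\<exists>qs. length qs = Suc (length w) \<and> qs ! 0 = q0 \<and>
        (\<forall>i<length w. (qs ! i, w ! i, qs ! Suc i) \<in> \<delta>) \<and> last qs \<in> Fin)"

definition regular_lang :: "'a set \<Rightarrow> 'a list set \<Rightarrow> bool" where
  "regular_lang \<Sigma> L \<longleftrightarrow>
     (\<exists>Q q0 \<delta> Fin. finite Q \<and> q0 \<in> Q \<and> Fin \<subseteq> Q \<and> \<delta> \<subseteq> Q \<times> \<Sigma> \<times> Q \<and>
        L = {w. set w \<subseteq> \<Sigma> \<and> nfa_accepts Q q0 \<delta> Fin w})"

text \<open>Context-free grammars: nonterminals are naturals, sentential forms are lists over
  nat + 'a (Inl = nonterminal, Inr = terminal), productions a finite set.\<close>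

definition cfg_step :: "(nat \<times> (nat + 'a) list) set \<Rightarrow> ((nat + 'a) list \<times> (nat + 'a) list) set" where
  "cfg_step P = {(u @ [Inl A] @ v, u @ rhs @ v) | u v A rhs. (A, rhs) \<in> P}"

definition context_free_lang :: "'a set \<Rightarrow> 'a list set \<Rightarrow> bool" where
  "context_free_lang \<Sigma> L \<longleftrightarrow>
     (\<exists>P S. finite P \<and> (\<forall>(A, rhs) \<in> P. \<forall>x \<in> set rhs. \<forall>a. x = Inr a \<longrightarrow> a \<in> \<Sigma>) \<and>
        L = {w. set w \<subseteq> \<Sigma> \<and> ([Inl S], map Inr w) \<in> (cfg_step P)\<^sup>*})"

section \<open>Infinite words and omega-languages\<close>

text \<open>Infinite words are maps nat => 'a (letter sigma_(n+1) is w n).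
  The infinite concatenation of the words v 0, v 1, ... is the infinite word whose
  prefix of length |v 0|+...+|v (k-1)| is v 0 @ ... @ v (k-1), for all k.\<close>

definition is_inf_concat :: "(nat \<Rightarrow> 'a list) \<Rightarrow> 'a word \<Rightarrow> bool" where
  "is_inf_concat v w \<longleftrightarrow>
     (\<forall>k. prefix (\<Sum>i<k. length (v i)) w = concat (map v [0..<k]))"

text \<open>V^omega: infinite concatenations of nonempty words from V.\<close>
definition omega_pow :: "'a list set \<Rightarrow> 'a word set" where
  "omega_pow V = {w. \<exists>v. (\<forall>i. v i \<in> V \<and> v i \<noteq> []) \<and> is_inf_concat v w}"

definition lang_conc :: "'a list set \<Rightarrow> 'a word set \<Rightarrow> 'a word set" where
  "lang_conc U W = {u \<frown> x | u x. u \<in> U \<and> x \<in> W}"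

text \<open>Letters are naturals; an alphabet is a nonempty finite set of naturals.\<close>

definition omega_RL :: "nat word set set" where
  "omega_RL = {L. \<exists>\<Sigma> ps. finite \<Sigma> \<and> \<Sigma> \<noteq> {} \<and>
      (\<forall>(U, V) \<in> set ps. regular_lang \<Sigma> U \<and> regular_lang \<Sigma> V) \<and>
      L = (\<Union>(U, V) \<in> set ps. lang_conc U (omega_pow V))}"

definition omega_CFL :: "nat word set set" where
  "omega_CFL = {L. \<exists>\<Sigma> ps. finite \<Sigma> \<and> \<Sigma> \<noteq> {} \<and>
      (\<forall>(U, V) \<in> set ps. context_free_lang \<Sigma> U \<and> context_free_lang \<Sigma> V) \<and>
      L = (\<Union>(U, V) \<in> set ps. lang_conc U (omega_pow V))}"

section \<open>Quantum automata with disturbing runs\<close>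

text \<open>The Hilbert space is C^d (vectors of dimension d), states are complex vectors,
  the inner product <psi|s> is s \<bullet>c psi = sum_i s_i * cnj(psi_i).\<close>

definition unitary_mat :: "nat \<Rightarrow> complex mat \<Rightarrow> bool" where
  "unitary_mat d U \<longleftrightarrow> U \<in> carrier_mat d d \<and>
     mat_adjoint U * U = 1\<^sub>m d \<and> U * mat_adjoint U = 1\<^sub>m d"

definition unit_vec_in :: "nat \<Rightarrow> complex vec \<Rightarrow> bool" where
  "unit_vec_in d v \<longleftrightarrow> v \<in> carrier_vec d \<and> v \<bullet>c v = 1"

definition is_subspace :: "nat \<Rightarrow> complex vec set \<Rightarrow> bool" where
  "is_subspace d F \<longleftrightarrow> F \<subseteq> carrier_vec d \<and> 0\<^sub>v d \<in> F \<and>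
     (\<forall>x\<in>F. \<forall>y\<in>F. x + y \<in> F) \<and> (\<forall>c. \<forall>x\<in>F. c \<cdot>\<^sub>v x \<in> F)"

text \<open>A quantum automaton (C^d, s0, Sigma, {U_sigma}, F).\<close>
definition quantum_automaton ::
  "nat \<Rightarrow> complex vec \<Rightarrow> nat set \<Rightarrow> (nat \<Rightarrow> complex mat) \<Rightarrow> complex vec set \<Rightarrow> bool" where
  "quantum_automaton d s0 \<Sigma> U F \<longleftrightarrow> d > 0 \<and> unit_vec_in d s0 \<and> finite \<Sigma> \<and> \<Sigma> \<noteq> {} \<and>
     (\<forall>a\<in>\<Sigma>. unitary_mat d (U a)) \<and> is_subspace d F"

text \<open>Disturbing run with reset vector psi and checkpoints N 0 < N 1 < ...
  (N i is the checkpoint n_(i+1) of the paper): s_0 = s0 and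
  s_(n+1) = U_(sigma_(n+1)) psi if n is a checkpoint, else U_(sigma_(n+1)) s_n,
  where sigma_(n+1) = w n.\<close>
fun disturbing_run ::
  "(nat \<Rightarrow> complex mat) \<Rightarrow> complex vec \<Rightarrow> complex vec \<Rightarrow> (nat \<Rightarrow> nat) \<Rightarrow> nat word \<Rightarrow> nat \<Rightarrow> complex vec" where
  "disturbing_run U s0 \<psi> N w 0 = s0"
| "disturbing_run U s0 \<psi> N w (Suc n) =
     U (w n) *\<^sub>v (if n \<in> range N then \<psi> else disturbing_run U s0 \<psi> N w n)"

definition checkpoints :: "(nat \<Rightarrow> nat) \<Rightarrow> bool" where
  "checkpoints N \<longleftrightarrow> strict_mono N"

text \<open>inf_i |<psi|s_(n_i)>|^2 for given psi and checkpoints.\<close>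
definition run_value ::
  "(nat \<Rightarrow> complex mat) \<Rightarrow> complex vec \<Rightarrow> complex vec \<Rightarrow> (nat \<Rightarrow> nat) \<Rightarrow> nat word \<Rightarrow> real" where
  "run_value U s0 \<psi> N w = (INF i. (cmod (disturbing_run U s0 \<psi> N w (N i) \<bullet>c \<psi>))\<^sup>2)"

text \<open>f^D(w) = sup over unit psi in F and checkpoint sequences of run_value
  (with the convention sup of the empty set = 0, relevant only when F = {0}).\<close>
definition fD ::
  "nat \<Rightarrow> complex vec \<Rightarrow> (nat \<Rightarrow> complex mat) \<Rightarrow> complex vec set \<Rightarrow> nat word \<Rightarrow> real" where
  "fD d s0 U F w =
     (let S = {run_value U s0 \<psi> N w | \<psi> N. \<psi> \<in> F \<and> unit_vec_in d \<psi> \<and> checkpoints N}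
      in if S = {} then 0 else Sup S)"

definition lang_gt ::
  "nat \<Rightarrow> complex vec \<Rightarrow> nat set \<Rightarrow> (nat \<Rightarrow> complex mat) \<Rightarrow> complex vec set \<Rightarrow> real \<Rightarrow> nat word set" where
  "lang_gt d s0 \<Sigma> U F lam = {w. range w \<subseteq> \<Sigma> \<and> fD d s0 U F w > lam}"

definition lang_eq1 ::
  "nat \<Rightarrow> complex vec \<Rightarrow> nat set \<Rightarrow> (nat \<Rightarrow> complex mat) \<Rightarrow> complex vec set \<Rightarrow> nat word set" where
  "lang_eq1 d s0 \<Sigma> U F = {w. range w \<subseteq> \<Sigma> \<and> fD d s0 U F w = 1}"

definition QBA_D_gt :: "real \<Rightarrow> nat word set set" where
  "QBA_D_gt lam = {L. \<exists>d s0 \<Sigma> U F. quantum_automaton d s0 \<Sigma> U F \<and> L = lang_gt d s0 \<Sigma> U F lam}"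

definition QBA_D_eq1 :: "nat word set set" where
  "QBA_D_eq1 = {L. \<exists>d s0 \<Sigma> U F. quantum_automaton d s0 \<Sigma> U F \<and> L = lang_eq1 d s0 \<Sigma> U F}"

end

theory Submission
  imports Defs
begin

(* Parts (1) and (2).  Suppose a quantum automaton accepts a^omega with value above lam, witnessed
   by a reset vector psi and checkpoints N.  Keep that run up to its first checkpoint and read b
   afterwards: by recurrence of the unitary U_b (pigeonhole on a finite grid of the unit sphere)
   some power U_b^m maps psi close enough to itself, so checkpoints placed every m steps keep the
   value above lam.  Hence an accepted language containing a^omega and some word using b also
   contains a^k b^omega for some k.  This rules out {0^omega, 1 0^omega}, which is omega-regular, and
   its union with {2^n 3^n 4^omega}, which is omega-context-free but, by pumping, not omega-regular.

   Part (3).  On C^2, let 0 and 1 rotate by +theta and -theta, where theta = arccos (3/5), and let the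
   reset vectors lie on the first axis.  The value of a run is the infimum of cos^2 of theta times the
   net counter change between consecutive checkpoints.  Since theta is not a rational multiple of pi,
   the word 0^m 1^n 2^omega reaches value 1 exactly when m = n, and the omega-regular pumping lemma
   shows that this language is not omega-regular. *)

section \<open>Unit vectors and unitary matrices\<close>

lemma cscalar_prod_eq_sum:
  "y \<in> carrier_vec d \<Longrightarrow> x \<bullet>c y = (\<Sum>i<d. x $ i * cnj (y $ i))"
  by (simp add: scalar_prod_def lessThan_atLeast0)

lemma unit_vec_sum_norm_sq:
  assumes "unit_vec_in d x"
  shows "(\<Sum>i<d. (cmod (x $ i))\<^sup>2) = 1"
proof -
  have x: "x \<in> carrier_vec d" and "x \<bullet>c x = 1" using assms unfolding unit_vec_in_def by auto
  moreover have "x \<bullet>c x = (\<Sum>i<d. complex_of_real ((cmod (x $ i))\<^sup>2))"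
    by (simp add: cscalar_prod_eq_sum[OF x] complex_norm_square del: of_real_power)
  ultimately show ?thesis by (metis of_real_eq_1_iff of_real_sum)
qed

lemma unit_vec_entry_le_1:
  assumes "unit_vec_in d x" "i < d"
  shows "cmod (x $ i) \<le> 1"
proof -
  have "(cmod (x $ i))\<^sup>2 \<le> (\<Sum>k<d. (cmod (x $ k))\<^sup>2)"
    using assms(2) by (intro member_le_sum) auto
  then show ?thesis
    using unit_vec_sum_norm_sq[OF assms(1)] by (simp add: power_le_one_iff abs_le_square_iff)
qed

lemma unit_vec_cscalar_prod_le_1:
  assumes "unit_vec_in d x" "unit_vec_in d y"
  shows "cmod (x \<bullet>c y) \<le> 1"
proof -
  have "y \<in> carrier_vec d" using assms(2) unfolding unit_vec_in_def by simp
  have "cmod (x \<bullet>c y) \<le> (\<Sum>i<d. cmod (x $ i) * cmod (y $ i))"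
    unfolding cscalar_prod_eq_sum[OF \<open>y \<in> carrier_vec d\<close>]
    by (rule order_trans[OF norm_sum]) (simp add: norm_mult)
  also have "\<dots> \<le> (\<Sum>i<d. ((cmod (x $ i))\<^sup>2 + (cmod (y $ i))\<^sup>2) / 2)"
    using sum_squares_bound[of "cmod (x $ _)" "cmod (y $ _)"] by (intro sum_mono) (simp add: mult_ac)
  also have "\<dots> = 1"
    using unit_vec_sum_norm_sq[OF assms(1)] unit_vec_sum_norm_sq[OF assms(2)]
    by (simp add: sum.distrib flip: sum_divide_distrib)
  finally show ?thesis .
qed

lemma mat_adjoint_entry:
  "U \<in> carrier_mat d d \<Longrightarrow> l < d \<Longrightarrow> i < d \<Longrightarrow> mat_adjoint U $$ (l, i) = cnj (U $$ (i, l))"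
  unfolding mat_adjoint_def by (simp add: mat_of_rows_def)

lemma unitary_columns_orthonormal:
  assumes "unitary_mat d U" "l < d" "k < d"
  shows "(\<Sum>i<d. cnj (U $$ (i, l)) * U $$ (i, k)) = (if l = k then 1 else 0)"
proof -
  have "U \<in> carrier_mat d d" using assms(1) unfolding unitary_mat_def by auto
  then have "(mat_adjoint U * U) $$ (l, k) = (\<Sum>i<d. cnj (U $$ (i, l)) * U $$ (i, k))"
    using assms by (simp add: scalar_prod_def mat_adjoint_entry mat_adjoint_def mat_of_rows_def
        lessThan_atLeast0)
  moreover have "mat_adjoint U * U = 1\<^sub>m d" using assms(1) unfolding unitary_mat_def by simp
  ultimately show ?thesis using assms by simp
qed

lemma unitary_cscalar_prod:
  assumes U: "unitary_mat d U" and x: "x \<in> carrier_vec d" and y: "y \<in> carrier_vec d"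
  shows "(U *\<^sub>v x) \<bullet>c (U *\<^sub>v y) = x \<bullet>c y"
proof -
  have "U \<in> carrier_mat d d" using U unfolding unitary_mat_def by auto
  then have "(U *\<^sub>v x) \<bullet>c (U *\<^sub>v y) =
      (\<Sum>i<d. (\<Sum>k<d. U $$ (i, k) * x $ k) * cnj (\<Sum>l<d. U $$ (i, l) * y $ l))"
    using x y by (simp add: scalar_prod_def lessThan_atLeast0)
  also have "\<dots> = (\<Sum>i<d. \<Sum>k<d. \<Sum>l<d. x $ k * cnj (y $ l) * (cnj (U $$ (i, l)) * U $$ (i, k)))"
    by (simp add: sum_distrib_left sum_distrib_right mult_ac) (rule sum.cong[OF refl], rule sum.swap)
  also have "\<dots> = (\<Sum>k<d. \<Sum>l<d. x $ k * cnj (y $ l) * (\<Sum>i<d. cnj (U $$ (i, l)) * U $$ (i, k)))"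
    by (simp add: sum_distrib_left, subst sum.swap, rule sum.cong, simp, subst sum.swap, simp)
  also have "\<dots> = x \<bullet>c y"
    using x y by (simp add: unitary_columns_orthonormal[OF U] cscalar_prod_eq_sum if_distrib cong: if_cong)
  finally show ?thesis .
qed

lemma unitary_unit_vec:
  assumes "unitary_mat d U" "unit_vec_in d x"
  shows "unit_vec_in d (U *\<^sub>v x)"
  using assms unitary_cscalar_prod[of d U x x] unfolding unit_vec_in_def unitary_mat_def by auto

lemma unitary_iter_carrier:
  "unitary_mat d U \<Longrightarrow> x \<in> carrier_vec d \<Longrightarrow> ((*\<^sub>v) U ^^ j) x \<in> carrier_vec d"
  by (induction j) (auto simp: unitary_mat_def)

lemma unitary_iter_cscalar_prod:
  assumes "unitary_mat d U" "x \<in> carrier_vec d" "y \<in> carrier_vec d"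
  shows "((*\<^sub>v) U ^^ j) x \<bullet>c ((*\<^sub>v) U ^^ j) y = x \<bullet>c y"
  using assms by (induction j) (simp_all add: unitary_cscalar_prod unitary_iter_carrier)

lemma unitary_iter_unit_vec:
  "unitary_mat d U \<Longrightarrow> unit_vec_in d x \<Longrightarrow> unit_vec_in d (((*\<^sub>v) U ^^ j) x)"
  by (induction j) (auto simp: unitary_unit_vec)

section \<open>Recurrence of unitary dynamics\<close>

lemma floor_eq_imp_dist_less:
  fixes x y :: real
  assumes "K > 0" "\<lfloor>x * K\<rfloor> = \<lfloor>y * K\<rfloor>"
  shows "\<bar>x - y\<bar> < 1 / K"
proof -
  have "\<bar>x * K - y * K\<bar> < 1"
    using assms(2) floor_correct[of "x * K"] floor_correct[of "y * K"] by linarith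
  moreover have "\<bar>x * K - y * K\<bar> = \<bar>x - y\<bar> * K"
    using assms(1) by (simp add: abs_mult flip: left_diff_distrib)
  ultimately show ?thesis using assms(1) by (simp add: field_simps)
qed

definition grid_cell :: "nat \<Rightarrow> nat \<Rightarrow> complex vec \<Rightarrow> (int \<times> int) list" where
  "grid_cell d K v = map (\<lambda>i. (\<lfloor>Re (v $ i) * K\<rfloor>, \<lfloor>Im (v $ i) * K\<rfloor>)) [0..<d]"

lemma finite_grid_cells_unit_vec: "finite (grid_cell d K ` {v. unit_vec_in d v})"
proof -
  define B where "B = {-int K..int K} \<times> {-int K..int K}"
  have floor_in: "\<lfloor>t * K\<rfloor> \<in> {-int K..int K}" if "\<bar>t\<bar> \<le> 1" for t :: real
  proof -
    have "\<bar>t * K\<bar> \<le> K" using that by (simp add: abs_mult mult_left_le_one_le)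
    then show ?thesis by (simp add: abs_le_iff le_floor_iff floor_le_iff)
  qed
  have "grid_cell d K v \<in> {zs. set zs \<subseteq> B \<and> length zs = d}" if "unit_vec_in d v" for v
  proof -
    have "\<bar>Re (v $ i)\<bar> \<le> 1" "\<bar>Im (v $ i)\<bar> \<le> 1" if "i < d" for i
      using unit_vec_entry_le_1[OF \<open>unit_vec_in d v\<close> that] abs_Re_le_cmod[of "v $ i"]
        abs_Im_le_cmod[of "v $ i"] by linarith+
    then show ?thesis unfolding grid_cell_def B_def using floor_in by auto
  qed
  then have "grid_cell d K ` {v. unit_vec_in d v} \<subseteq> {zs. set zs \<subseteq> B \<and> length zs = d}" by auto
  moreover have "finite {zs. set zs \<subseteq> B \<and> length zs = d}"
    by (rule finite_lists_length_eq) (simp add: B_def)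
  ultimately show ?thesis by (rule finite_subset)
qed

lemma grid_cell_eq_imp_close:
  assumes "K > 0" "grid_cell d K u = grid_cell d K v" "i < d"
  shows "cmod (u $ i - v $ i) < 2 / K"
proof -
  have "grid_cell d K u ! i = grid_cell d K v ! i" using assms(2) by simp
  then have re: "\<lfloor>Re (u $ i) * K\<rfloor> = \<lfloor>Re (v $ i) * K\<rfloor>"
    and im: "\<lfloor>Im (u $ i) * K\<rfloor> = \<lfloor>Im (v $ i) * K\<rfloor>"
    using assms(3) unfolding grid_cell_def by auto
  have "\<bar>Re (u $ i - v $ i)\<bar> < 1 / K" "\<bar>Im (u $ i - v $ i)\<bar> < 1 / K"
    using floor_eq_imp_dist_less[of K, OF _ re] floor_eq_imp_dist_less[of K, OF _ im] assms(1) by simp_all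
  then show ?thesis using cmod_le[of "u $ i - v $ i"] by simp
qed

lemma unit_vec_seq_close_pair:
  fixes a :: "nat \<Rightarrow> complex vec"
  assumes unit: "\<And>j. unit_vec_in d (a j)" and "\<epsilon> > 0"
  obtains j1 j2 where "j1 < j2" "\<And>i. i < d \<Longrightarrow> cmod (a j2 $ i - a j1 $ i) \<le> \<epsilon>"
proof -
  obtain K :: nat where K\<epsilon>: "2 / \<epsilon> < K" using reals_Archimedean2 by blast
  have "0 < 2 / \<epsilon>" using \<open>\<epsilon> > 0\<close> by simp
  then have K: "real K > 0" using K\<epsilon> by linarith
  have "2 < \<epsilon> * K" using K\<epsilon> \<open>\<epsilon> > 0\<close> by (simp add: divide_less_eq mult.commute)
  then have "2 / K \<le> \<epsilon>" using K by (simp add: divide_le_eq mult.commute)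
  have "range (grid_cell d K \<circ> a) \<subseteq> grid_cell d K ` {v. unit_vec_in d v}" using unit by auto
  then have "finite (range (grid_cell d K \<circ> a))"
    using finite_grid_cells_unit_vec by (rule finite_subset)
  then have "\<not> inj (grid_cell d K \<circ> a)" using finite_imageD infinite_UNIV_nat by blast
  then obtain j1 j2 where "j1 \<noteq> j2" "grid_cell d K (a j1) = grid_cell d K (a j2)"
    unfolding inj_def by auto
  then obtain j1 j2 where j: "j1 < j2" "grid_cell d K (a j2) = grid_cell d K (a j1)"
    by (metis linorder_neqE_nat)
  show thesis
  proof (rule that[OF j(1)])
    fix i assume "i < d"
    then have "cmod (a j2 $ i - a j1 $ i) < 2 / K" using K j(2) by (intro grid_cell_eq_imp_close) simp_all
    with \<open>2 / K \<le> \<epsilon>\<close> show "cmod (a j2 $ i - a j1 $ i) \<le> \<epsilon>" by simp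
  qed
qed

lemma unit_vec_cscalar_prod_close_to_1:
  assumes x: "unit_vec_in d x" and y: "unit_vec_in d y"
    and close: "\<And>i. i < d \<Longrightarrow> cmod (y $ i - x $ i) \<le> \<epsilon>"
  shows "cmod (y \<bullet>c x - 1) \<le> d * \<epsilon>"
proof -
  have xc: "x \<in> carrier_vec d" and yc: "y \<in> carrier_vec d" and "x \<bullet>c x = 1"
    using x y unfolding unit_vec_in_def by auto
  then have "y \<bullet>c x - 1 = (\<Sum>i<d. (y $ i - x $ i) * cnj (x $ i))"
    by (simp add: cscalar_prod_eq_sum[OF xc] sum_subtractf left_diff_distrib)
  then have "cmod (y \<bullet>c x - 1) \<le> (\<Sum>i<d. cmod (y $ i - x $ i) * cmod (x $ i))"
    by (simp add: order_trans[OF norm_sum] norm_mult)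
  also have "\<dots> \<le> (\<Sum>i<d. \<epsilon>)"
  proof (intro sum_mono)
    fix i assume "i \<in> {..<d}"
    then have "cmod (y $ i - x $ i) * cmod (x $ i) \<le> cmod (y $ i - x $ i)"
      using unit_vec_entry_le_1[OF x] by (simp add: mult_right_le_one_le)
    also have "\<dots> \<le> \<epsilon>" using close \<open>i \<in> {..<d}\<close> by simp
    finally show "cmod (y $ i - x $ i) * cmod (x $ i) \<le> \<epsilon>" .
  qed
  finally show ?thesis by simp
qed

lemma unitary_recurrence:
  assumes U: "unitary_mat d U" and \<psi>: "unit_vec_in d \<psi>" and "\<epsilon> > 0"
  obtains m where "m \<ge> 1" "cmod (((*\<^sub>v) U ^^ m) \<psi> \<bullet>c \<psi> - 1) < \<epsilon>"
proof -
  define a where "a j = ((*\<^sub>v) U ^^ j) \<psi>" for j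
  have unit: "unit_vec_in d (a j)" for j
    unfolding a_def using unitary_iter_unit_vec[OF U \<psi>] .
  have "\<epsilon> / (d + 1) > 0" using \<open>\<epsilon> > 0\<close> by simp
  then obtain j1 j2 where j: "j1 < j2" and close: "\<And>i. i < d \<Longrightarrow> cmod (a j2 $ i - a j1 $ i) \<le> \<epsilon> / (d + 1)"
    by (rule unit_vec_seq_close_pair[of d a, OF unit]) blast
  define m where "m = j2 - j1"
  have "a j2 \<bullet>c a j1 = ((*\<^sub>v) U ^^ j1) (a m) \<bullet>c ((*\<^sub>v) U ^^ j1) \<psi>"
    using j unfolding a_def m_def by (metis funpow_add le_add_diff_inverse less_imp_le o_apply)
  also have "\<dots> = a m \<bullet>c \<psi>"
    using unit[of m] \<psi> by (simp add: unitary_iter_cscalar_prod[OF U] unit_vec_in_def)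
  finally have "cmod (a m \<bullet>c \<psi> - 1) \<le> d * (\<epsilon> / (d + 1))"
    using unit_vec_cscalar_prod_close_to_1[OF unit unit close] by metis
  also have "\<dots> < \<epsilon>" using \<open>\<epsilon> > 0\<close> by (simp add: field_simps)
  finally show thesis using j by (intro that[of m]) (simp_all add: m_def a_def)
qed

lemma norm_sq_gt_of_close_to_1:
  fixes z :: complex
  assumes "cmod (z - 1) < \<epsilon>" "\<epsilon> \<le> 1"
  shows "1 - 2 * \<epsilon> < (cmod z)\<^sup>2"
proof -
  have "1 - \<epsilon> < cmod z" using assms(1) norm_triangle_ineq2[of 1 z] by (simp add: norm_minus_commute)
  moreover have "0 \<le> 1 - \<epsilon>" using assms(2) by simp
  ultimately have "(1 - \<epsilon>)\<^sup>2 < (cmod z)\<^sup>2" by (simp add: power_strict_mono)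
  moreover have "1 - 2 * \<epsilon> \<le> (1 - \<epsilon>)\<^sup>2" by (simp add: power2_eq_square algebra_simps)
  ultimately show ?thesis by linarith
qed

section \<open>Disturbing runs\<close>

lemma disturbing_run_unit_vec:
  assumes "unit_vec_in d s0" "unit_vec_in d \<psi>" "\<And>t. unitary_mat d (U (w t))"
  shows "unit_vec_in d (disturbing_run U s0 \<psi> N w n)"
  using assms by (induction n) (auto intro: unitary_unit_vec)

lemma disturbing_run_cong:
  assumes "\<forall>t<n. w t = w' t" "\<forall>t<n. t \<notin> range N" "\<forall>t<n. t \<notin> range N'"
  shows "disturbing_run U s0 \<psi> N w n = disturbing_run U s0 \<psi> N' w' n"
  using assms by (induction n) auto

lemma disturbing_run_after_checkpoint:
  assumes "n \<in> range N" "\<forall>t. n < t \<and> t \<le> n + k \<longrightarrow> t \<notin> range N"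
    "\<forall>t. n \<le> t \<and> t \<le> n + k \<longrightarrow> w t = c"
  shows "disturbing_run U s0 \<psi> N w (Suc (n + k)) = ((*\<^sub>v) (U c) ^^ Suc k) \<psi>"
  using assms by (induction k) auto

lemma run_value_le:
  "run_value U s0 \<psi> N w \<le> (cmod (disturbing_run U s0 \<psi> N w (N i) \<bullet>c \<psi>))\<^sup>2"
  unfolding run_value_def by (rule cINF_lower) (auto intro: bdd_belowI[of _ 0])

lemma run_value_le_1:
  assumes "unit_vec_in d s0" "unit_vec_in d \<psi>" "\<And>t. unitary_mat d (U (w t))"
  shows "run_value U s0 \<psi> N w \<le> 1"
proof -
  have "cmod (disturbing_run U s0 \<psi> N w (N 0) \<bullet>c \<psi>) \<le> 1"
    using assms by (intro unit_vec_cscalar_prod_le_1 disturbing_run_unit_vec)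
  then have "(cmod (disturbing_run U s0 \<psi> N w (N 0) \<bullet>c \<psi>))\<^sup>2 \<le> 1"
    by (simp add: power_le_one)
  with run_value_le show ?thesis by (rule order_trans)
qed

text \<open>The hypothesis \<open>0 \<le> c\<close> covers the case without admissible runs, where \<open>fD\<close> is \<open>0\<close>.\<close>
lemma fD_le:
  assumes "\<And>\<psi> N. \<psi> \<in> F \<Longrightarrow> unit_vec_in d \<psi> \<Longrightarrow> checkpoints N \<Longrightarrow> run_value U s0 \<psi> N w \<le> c"
    and "0 \<le> c"
  shows "fD d s0 U F w \<le> c"
  using assms unfolding fD_def Let_def by (auto intro!: cSup_least)

lemma fD_ge:
  assumes "unit_vec_in d s0" "\<And>t. unitary_mat d (U (w t))"
    and "\<psi> \<in> F" "unit_vec_in d \<psi>" "checkpoints N"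
  shows "run_value U s0 \<psi> N w \<le> fD d s0 U F w"
proof -
  let ?S = "{run_value U s0 \<psi> N w | \<psi> N. \<psi> \<in> F \<and> unit_vec_in d \<psi> \<and> checkpoints N}"
  have "run_value U s0 \<psi> N w \<in> ?S" using assms by blast
  moreover have "bdd_above ?S"
    using assms(1,2) run_value_le_1 by (auto intro!: bdd_aboveI[of _ 1])
  ultimately show ?thesis unfolding fD_def Let_def by (auto intro: cSup_upper)
qed

text \<open>The run on \<open>a\<^sup>\<omega>\<close> is kept up to its first checkpoint; afterwards \<open>b\<close> is read and the
  checkpoints are placed every \<open>m\<close> steps, so that each later checkpoint sees \<open>(U b)\<^sup>m \<psi>\<close>.\<close>
lemma run_value_switch_ge:
  assumes N: "checkpoints N" and m: "m \<ge> 1"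
  shows "min ((cmod (disturbing_run U s0 \<psi> N (\<lambda>_. a) (N 0) \<bullet>c \<psi>))\<^sup>2)
      ((cmod (((*\<^sub>v) (U b) ^^ m) \<psi> \<bullet>c \<psi>))\<^sup>2)
    \<le> run_value U s0 \<psi> (\<lambda>i. N 0 + i * m) (replicate (N 0) a \<frown> (\<lambda>_. b))"
proof -
  define N' where "N' i = N 0 + i * m" for i
  define w' where "w' = replicate (N 0) a \<frown> (\<lambda>_. b)"
  have "disturbing_run U s0 \<psi> N' w' (N 0) = disturbing_run U s0 \<psi> N (\<lambda>_. a) (N 0)"
  proof (rule disturbing_run_cong)
    show "\<forall>t<N 0. w' t = a" unfolding w'_def by simp
    show "\<forall>t<N 0. t \<notin> range N'" unfolding N'_def by auto
    show "\<forall>t<N 0. t \<notin> range N"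
      using N unfolding checkpoints_def by (auto simp: strict_mono_less_eq not_le[symmetric])
  qed
  then have at_first: "disturbing_run U s0 \<psi> N' w' (N' 0) = disturbing_run U s0 \<psi> N (\<lambda>_. a) (N 0)"
    by (simp add: N'_def)
  have at_later: "disturbing_run U s0 \<psi> N' w' (N' (Suc i)) = ((*\<^sub>v) (U b) ^^ m) \<psi>" for i
  proof -
    obtain m' where m': "m = Suc m'" using m by (cases m) auto
    have "t \<notin> range N'" if "N' i < t" "t \<le> N' i + m'" for t
    proof
      assume "t \<in> range N'"
      then obtain j where "t = N' j" by auto
      with that have "i * m < j * m" "j * m < Suc i * m" unfolding N'_def m' by auto
      then have "i < j" "j < Suc i" using mult_less_cancel2 by blast+
      then show False by simp
    qed
    moreover have "w' t = b" if "N' i \<le> t" for t using that unfolding w'_def N'_def by simp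
    ultimately have "disturbing_run U s0 \<psi> N' w' (Suc (N' i + m')) = ((*\<^sub>v) (U b) ^^ Suc m') \<psi>"
      by (intro disturbing_run_after_checkpoint) auto
    then show ?thesis unfolding m' N'_def by (simp add: algebra_simps)
  qed
  show ?thesis
    unfolding run_value_def N'_def[symmetric] w'_def[symmetric]
    by (intro cINF_greatest) (simp, metis at_first at_later min.cobounded1 min.cobounded2 not0_implies_Suc)
qed

lemma QBA_D_gt_switch:
  assumes L: "L \<in> QBA_D_gt lam" and lam: "0 \<le> lam" "lam < 1"
    and const: "(\<lambda>_. a) \<in> L" and w: "w \<in> L" "b \<in> range w"
  shows "\<exists>k. replicate k a \<frown> (\<lambda>_. b) \<in> L"
proof -
  obtain d s0 \<Sigma> U F where QA: "quantum_automaton d s0 \<Sigma> U F" and L: "L = lang_gt d s0 \<Sigma> U F lam"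
    using L unfolding QBA_D_gt_def by blast
  have s0: "unit_vec_in d s0" and unitary: "\<And>c. c \<in> \<Sigma> \<Longrightarrow> unitary_mat d (U c)"
    using QA unfolding quantum_automaton_def by auto
  have "a \<in> \<Sigma>" "b \<in> \<Sigma>" and gt: "lam < fD d s0 U F (\<lambda>_. a)"
    using const w unfolding L lang_gt_def by auto
  then obtain \<psi> N where \<psi>: "\<psi> \<in> F" "unit_vec_in d \<psi>" and N: "checkpoints N"
    and "lam < run_value U s0 \<psi> N (\<lambda>_. a)"
    using fD_le[of F d U s0 "\<lambda>_. a" lam] lam(1) by (meson not_le)
  then have first: "lam < (cmod (disturbing_run U s0 \<psi> N (\<lambda>_. a) (N 0) \<bullet>c \<psi>))\<^sup>2"
    using run_value_le order.strict_trans2 by blast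
  obtain m where m: "m \<ge> 1" and close: "cmod (((*\<^sub>v) (U b) ^^ m) \<psi> \<bullet>c \<psi> - 1) < (1 - lam) / 2"
    using unitary_recurrence[OF unitary[OF \<open>b \<in> \<Sigma>\<close>] \<psi>(2)] lam(2) by (metis diff_gt_0_iff_gt half_gt_zero)
  have return: "lam < (cmod (((*\<^sub>v) (U b) ^^ m) \<psi> \<bullet>c \<psi>))\<^sup>2"
    using norm_sq_gt_of_close_to_1[OF close] lam by (simp add: field_simps)
  define w' where "w' = replicate (N 0) a \<frown> (\<lambda>_. b)"
  have w'_\<Sigma>: "range w' \<subseteq> \<Sigma>" using \<open>a \<in> \<Sigma>\<close> \<open>b \<in> \<Sigma>\<close> unfolding w'_def by auto
  have N': "checkpoints (\<lambda>i. N 0 + i * m)" using m unfolding checkpoints_def strict_mono_def by simp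
  have "lam < min ((cmod (disturbing_run U s0 \<psi> N (\<lambda>_. a) (N 0) \<bullet>c \<psi>))\<^sup>2)
      ((cmod (((*\<^sub>v) (U b) ^^ m) \<psi> \<bullet>c \<psi>))\<^sup>2)"
    using first return by simp
  also have "\<dots> \<le> run_value U s0 \<psi> (\<lambda>i. N 0 + i * m) w'"
    unfolding w'_def by (rule run_value_switch_ge[OF N m])
  also have "\<dots> \<le> fD d s0 U F w'"
    using w'_\<Sigma> unitary by (intro fD_ge[OF s0 _ \<psi> N']) auto
  finally show ?thesis using w'_\<Sigma> unfolding L lang_gt_def w'_def by blast
qed

section \<open>Pumping for omega-regular languages\<close>

lemma nfa_accepts_pump:
  assumes acc: "nfa_accepts Q q0 \<delta> Fin u" and \<delta>: "\<delta> \<subseteq> Q \<times> \<Sigma> \<times> Q" and "finite Q"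
    and K: "card Q \<le> K" "K < length u"
  shows "\<exists>i j. i < j \<and> j \<le> K \<and> nfa_accepts Q q0 \<delta> Fin (take j u @ drop i u)"
proof -
  obtain qs where qs: "length qs = Suc (length u)" "qs ! 0 = q0"
    "\<forall>t<length u. (qs ! t, u ! t, qs ! Suc t) \<in> \<delta>" "last qs \<in> Fin"
    using acc unfolding nfa_accepts_def by blast
  have "qs ! t \<in> Q" if "t < length u" for t using qs(3) \<delta> that by blast
  then have "(!) qs ` {0..K} \<subseteq> Q" using K(2) by auto
  then have "\<not> inj_on ((!) qs) {0..K}"
    using card_inj_on_le[of "(!) qs" "{0..K}" Q] \<open>finite Q\<close> K(1) by auto
  then obtain t1 t2 where "t1 \<le> K" "t2 \<le> K" "t1 \<noteq> t2" "qs ! t1 = qs ! t2"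
    unfolding inj_on_def by auto
  then obtain i j where ij: "i < j" "j \<le> K" "qs ! i = qs ! j" by (metis linorder_neqE_nat)
  define u' where "u' = take j u @ drop i u"
  define qs' where "qs' = take j qs @ drop i qs"
  have len: "length u' = j + (length u - i)" "length qs' = Suc (length u')"
    unfolding u'_def qs'_def using ij K qs by auto
  have u': "u' ! t = (if t < j then u ! t else u ! (i + t - j))" if "t < length u'" for t
    using that ij K unfolding u'_def len by (auto simp: nth_append)
  have qs': "qs' ! t = (if t < j then qs ! t else qs ! (i + t - j))" if "t \<le> length u'" for t
    using that ij K qs unfolding qs'_def len by (auto simp: nth_append)
  have "(qs' ! t, u' ! t, qs' ! Suc t) \<in> \<delta>" if "t < length u'" for t
  proof (cases "t < j")
    case True
    then have "qs' ! Suc t = qs ! Suc t"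
      using qs'[of "Suc t"] that ij(3) by (cases "Suc t = j") auto
    then show ?thesis using True qs'[of t] u'[OF that] that qs(3) ij K by simp
  next
    case False
    then have "i + t - j < length u" "i + Suc t - j = Suc (i + t - j)"
      using that len ij by auto
    then show ?thesis using False qs'[of t] qs'[of "Suc t"] u'[OF that] that qs(3) by simp
  qed
  moreover have "qs' ! 0 = q0" "last qs' \<in> Fin"
    unfolding qs'_def using ij K qs by (auto simp: nth_append last_append last_drop)
  ultimately have "nfa_accepts Q q0 \<delta> Fin u'"
    unfolding nfa_accepts_def using len by blast
  with ij show ?thesis unfolding u'_def by blast
qed

text \<open>\<open>take j u @ drop i u\<close> repeats the factor of \<open>u\<close> between positions \<open>i\<close> and \<open>j\<close>.\<close>
definition pumpable :: "nat \<Rightarrow> 'a list set \<Rightarrow> bool" where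
  "pumpable K U \<longleftrightarrow> (\<forall>u\<in>U. K < length u \<longrightarrow> (\<exists>i j. i < j \<and> j \<le> K \<and> take j u @ drop i u \<in> U))"

lemma pumpable_mono: "pumpable K U \<Longrightarrow> K \<le> K' \<Longrightarrow> pumpable K' U"
  unfolding pumpable_def by (meson le_trans le_less_trans)

lemma regular_lang_pumpable:
  assumes "regular_lang \<Sigma> U"
  shows "\<exists>K. pumpable K U"
proof -
  obtain Q q0 \<delta> Fin where Q: "finite Q" "\<delta> \<subseteq> Q \<times> \<Sigma> \<times> Q"
    and U: "U = {w. set w \<subseteq> \<Sigma> \<and> nfa_accepts Q q0 \<delta> Fin w}"
    using assms unfolding regular_lang_def by blast
  have "pumpable (card Q) U" unfolding pumpable_def
  proof (intro ballI impI)
    fix u assume "u \<in> U" "card Q < length u"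
    then have "set u \<subseteq> \<Sigma>" "nfa_accepts Q q0 \<delta> Fin u" using U by auto
    then obtain i j where "i < j" "j \<le> card Q" "nfa_accepts Q q0 \<delta> Fin (take j u @ drop i u)"
      using nfa_accepts_pump[OF _ Q(2,1) order.refl \<open>card Q < length u\<close>] by blast
    moreover have "set (take j u @ drop i u) \<subseteq> \<Sigma>"
      using \<open>set u \<subseteq> \<Sigma>\<close> set_take_subset set_drop_subset by fastforce
    ultimately show "\<exists>i j. i < j \<and> j \<le> card Q \<and> take j u @ drop i u \<in> U" using U by blast
  qed
  then show ?thesis ..
qed

lemma pumpable_common_bound:
  assumes "finite \<U>" "\<forall>U\<in>\<U>. \<exists>K. pumpable K U"
  shows "\<exists>K. \<forall>U\<in>\<U>. pumpable K U"
proof -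
  obtain f where f: "\<And>U. U \<in> \<U> \<Longrightarrow> pumpable (f U) U" using bchoice[OF assms(2)] by blast
  have "pumpable (\<Sum>V\<in>\<U>. f V) U" if "U \<in> \<U>" for U
    using member_le_sum[OF that _ assms(1), of f] by (intro pumpable_mono[OF f[OF that]]) simp
  then show ?thesis by blast
qed

lemma omega_pow_conc:
  assumes "v \<in> V" "v \<noteq> []" "x \<in> omega_pow V"
  shows "v \<frown> x \<in> omega_pow V"
proof -
  obtain vs where vs: "\<forall>i. vs i \<in> V \<and> vs i \<noteq> []" "is_inf_concat vs x"
    using assms(3) unfolding omega_pow_def by blast
  have "is_inf_concat (case_nat v vs) (v \<frown> x)"
    unfolding is_inf_concat_def
  proof
    fix k
    show "prefix (\<Sum>i<k. length (case_nat v vs i)) (v \<frown> x) = concat (map (case_nat v vs) [0..<k])"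
    proof (cases k)
      case (Suc k')
      have "(\<Sum>i<k. length (case_nat v vs i)) = length v + (\<Sum>i<k'. length (vs i))"
        unfolding Suc by (subst sum.lessThan_Suc_shift) simp
      moreover have "concat (map (case_nat v vs) [0..<k]) = v @ concat (map vs [0..<k'])"
        unfolding Suc by (simp add: upt_conv_Cons map_Suc_upt[symmetric] comp_def del: upt_Suc)
      ultimately show ?thesis using vs(2) unfolding is_inf_concat_def by simp
    qed simp
  qed
  with vs(1) assms(1,2) show ?thesis
    unfolding omega_pow_def by (auto intro!: exI[of _ "case_nat v vs"] split: nat.splits)
qed

lemma omega_powE:
  assumes "x \<in> omega_pow V"
  obtains v x' where "v \<in> V" "v \<noteq> []" "x' \<in> omega_pow V" "x = v \<frown> x'"
proof -
  obtain vs where vs: "\<forall>i. vs i \<in> V \<and> vs i \<noteq> []" "is_inf_concat vs x"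
    using assms unfolding omega_pow_def by blast
  define l where "l = length (vs 0)"
  have prefix: "prefix (l + (\<Sum>i<k. length (vs (Suc i)))) x = vs 0 @ concat (map (vs \<circ> Suc) [0..<k])" for k
  proof -
    have "(\<Sum>i<Suc k. length (vs i)) = l + (\<Sum>i<k. length (vs (Suc i)))"
      unfolding l_def by (subst sum.lessThan_Suc_shift) simp
    moreover have "concat (map vs [0..<Suc k]) = vs 0 @ concat (map (vs \<circ> Suc) [0..<k])"
      by (simp add: upt_conv_Cons map_Suc_upt[symmetric] del: upt_Suc)
    ultimately show ?thesis using vs(2) unfolding is_inf_concat_def by metis
  qed
  have "is_inf_concat (vs \<circ> Suc) (suffix l x)"
    unfolding is_inf_concat_def
  proof
    fix k
    let ?S = "\<Sum>i<k. length (vs (Suc i))"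
    have "prefix ?S (suffix l x) = x [l \<rightarrow> l + ?S]"
      using subsequence_prefix_suffix[where i = l and j = "l + ?S" and w = x] by simp
    also have "\<dots> = drop l (prefix (l + ?S) x)" by simp
    also have "\<dots> = concat (map (vs \<circ> Suc) [0..<k])" unfolding prefix by (simp add: l_def)
    finally show "prefix (\<Sum>i<k. length ((vs \<circ> Suc) i)) (suffix l x) = concat (map (vs \<circ> Suc) [0..<k])"
      by simp
  qed
  then have "suffix l x \<in> omega_pow V"
    using vs(1) unfolding omega_pow_def by (auto intro!: exI[of _ "vs \<circ> Suc"])
  moreover have "x = vs 0 \<frown> suffix l x"
    using prefix[of 0] prefix_suffix[of x l] by simp
  ultimately show thesis using vs(1) that by blast
qed

lemma lang_concI: "u \<in> U \<Longrightarrow> x \<in> W \<Longrightarrow> u \<frown> x \<in> lang_conc U W"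
  unfolding lang_conc_def by blast

text \<open>Either the finite prefix \<open>u\<close> is long and is pumped, or the first factor \<open>v\<close> of the
  infinite part is long and is pumped, or \<open>u v\<close> is short and \<open>v\<close> is repeated.\<close>
lemma lang_conc_omega_pow_pump:
  assumes U: "pumpable K U" and V: "pumpable K V" and w: "w \<in> lang_conc U (omega_pow V)"
  shows "\<exists>i j. i < j \<and> j \<le> 2 * K \<and> prefix j w \<frown> suffix i w \<in> lang_conc U (omega_pow V)"
proof -
  obtain u x where u: "u \<in> U" and x: "x \<in> omega_pow V" and w: "w = u \<frown> x"
    using w unfolding lang_conc_def by blast
  show ?thesis
  proof (cases "K < length u")
    case True
    then obtain i j where ij: "i < j" "j \<le> K" and u': "take j u @ drop i u \<in> U"
      using U u unfolding pumpable_def by blast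
    have "prefix j w \<frown> suffix i w = (take j u @ drop i u) \<frown> x"
      using ij True unfolding w by simp
    with ij show ?thesis using lang_concI[OF u' x] by (intro exI[of _ i] exI[of _ j]) simp
  next
    case False
    obtain v x' where v: "v \<in> V" "v \<noteq> []" and x': "x' \<in> omega_pow V" and x: "x = v \<frown> x'"
      using omega_powE[OF x] by blast
    show ?thesis
    proof (cases "K < length v")
      case True
      then obtain i j where ij: "i < j" "j \<le> K" and v': "take j v @ drop i v \<in> V"
        using V v unfolding pumpable_def by blast
      have "take j v @ drop i v \<noteq> []" using ij True by simp
      then have "u \<frown> ((take j v @ drop i v) \<frown> x') \<in> lang_conc U (omega_pow V)"
        using u v' x' by (intro lang_concI omega_pow_conc)
      moreover have "prefix (length u + j) w \<frown> suffix (length u + i) w =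
          u \<frown> ((take j v @ drop i v) \<frown> x')"
        using ij True unfolding w x by simp
      ultimately show ?thesis
        using ij \<open>\<not> K < length u\<close> by (intro exI[of _ "length u + i"] exI[of _ "length u + j"]) simp
    next
      case False
      have "u \<frown> (v \<frown> (v \<frown> x')) \<in> lang_conc U (omega_pow V)"
        using u v x' by (intro lang_concI omega_pow_conc)
      moreover have "prefix (length u + length v) w \<frown> suffix (length u) w = u \<frown> (v \<frown> (v \<frown> x'))"
        unfolding w x by simp
      ultimately show ?thesis
        using False \<open>\<not> K < length u\<close> v(2)
        by (intro exI[of _ "length u"] exI[of _ "length u + length v"]) simp
    qed
  qed
qed

lemma omega_RL_pump:
  assumes "L \<in> omega_RL"
  shows "\<exists>K. \<forall>w\<in>L. \<exists>i j. i < j \<and> j \<le> K \<and> prefix j w \<frown> suffix i w \<in> L"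
proof -
  obtain \<Sigma> ps where reg: "\<forall>(U, V) \<in> set ps. regular_lang \<Sigma> U \<and> regular_lang \<Sigma> V"
    and L: "L = (\<Union>(U, V) \<in> set ps. lang_conc U (omega_pow V))"
    using assms unfolding omega_RL_def by blast
  define \<U> where "\<U> = fst ` set ps \<union> snd ` set ps"
  have "\<exists>K. pumpable K U" if "U \<in> \<U>" for U
  proof -
    have "regular_lang \<Sigma> U" using that reg unfolding \<U>_def by auto
    then show ?thesis by (rule regular_lang_pumpable)
  qed
  then obtain K where K: "\<forall>U\<in>\<U>. pumpable K U"
    using pumpable_common_bound[of \<U>] unfolding \<U>_def by blast
  have "\<exists>i j. i < j \<and> j \<le> 2 * K \<and> prefix j w \<frown> suffix i w \<in> L" if "w \<in> L" for w
  proof -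
    obtain U V where UV: "(U, V) \<in> set ps" and w: "w \<in> lang_conc U (omega_pow V)"
      using \<open>w \<in> L\<close> unfolding L by blast
    have "U \<in> \<U>" "V \<in> \<U>" using UV unfolding \<U>_def by (auto intro: rev_image_eqI)
    then obtain i j where "i < j" "j \<le> 2 * K" "prefix j w \<frown> suffix i w \<in> lang_conc U (omega_pow V)"
      using lang_conc_omega_pow_pump[OF _ _ w] K by blast
    then show ?thesis using UV unfolding L by blast
  qed
  then show ?thesis by blast
qed

definition abc_word :: "'a \<Rightarrow> 'a \<Rightarrow> 'a \<Rightarrow> nat \<Rightarrow> nat \<Rightarrow> 'a word" where
  "abc_word a b c m n = (replicate m a @ replicate n b) \<frown> (\<lambda>_. c)"

lemma abc_word_nth: "abc_word a b c m n t = (if t < m then a else if t < m + n then b else c)"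
  by (simp add: abc_word_def conc_def nth_append)

lemma abc_word_range: "range (abc_word a b c m n) \<subseteq> {a, b, c}"
  by (auto simp: abc_word_nth)

lemma abc_word_pump:
  assumes "i < j" "j \<le> m"
  shows "prefix j (abc_word a b c m n) \<frown> suffix i (abc_word a b c m n) = abc_word a b c (m + j - i) n"
proof -
  have "replicate j a @ replicate (m - i) a = replicate (m + j - i) a"
    using assms by (simp flip: replicate_add)
  then show ?thesis using assms unfolding abc_word_def by simp
qed

lemma abc_not_omega_RL:
  assumes "\<And>n. abc_word a b c n n \<in> L" "\<And>m n. n < m \<Longrightarrow> abc_word a b c m n \<notin> L"
  shows "L \<notin> omega_RL"
proof
  assume "L \<in> omega_RL"
  then obtain K where "\<forall>w\<in>L. \<exists>i j. i < j \<and> j \<le> K \<and> prefix j w \<frown> suffix i w \<in> L"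
    using omega_RL_pump by blast
  then obtain i j where "i < j" "j \<le> K"
    and "prefix j (abc_word a b c K K) \<frown> suffix i (abc_word a b c K K) \<in> L"
    using assms(1) by blast
  then have "abc_word a b c (K + j - i) K \<in> L" by (simp add: abc_word_pump)
  with assms(2) \<open>i < j\<close> show False by fastforce
qed

section \<open>The omega-regular and omega-context-free examples\<close>

lemma regular_lang_singleton:
  assumes "set w \<subseteq> \<Sigma>"
  shows "regular_lang \<Sigma> {w}"
proof -
  define \<delta> where "\<delta> = {(i, w ! i, Suc i) | i. i < length w}"
  have accepts: "nfa_accepts {0..length w} 0 \<delta> {length w} v \<longleftrightarrow> v = w" for v
  proof
    assume "nfa_accepts {0..length w} 0 \<delta> {length w} v"
    then obtain qs where qs: "length qs = Suc (length v)" "qs ! 0 = 0"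
      "\<forall>i<length v. (qs ! i, v ! i, qs ! Suc i) \<in> \<delta>" "last qs = length w"
      unfolding nfa_accepts_def by blast
    have step: "qs ! Suc i = Suc (qs ! i) \<and> v ! i = w ! (qs ! i)" if "i < length v" for i
      using qs(3) that unfolding \<delta>_def by auto
    have at: "qs ! i = i" if "i \<le> length v" for i
      using that by (induction i) (auto simp: qs(2) step)
    have "qs \<noteq> []" using qs(1) by auto
    then have "length v = length w"
      using qs(1,4) at[of "length v"] by (simp add: last_conv_nth)
    moreover have "v ! i = w ! i" if "i < length v" for i
      using step[OF that] at[of i] that by simp
    ultimately show "v = w" by (simp add: nth_equalityI)
  next
    assume "v = w"
    then show "nfa_accepts {0..length w} 0 \<delta> {length w} v"
      unfolding nfa_accepts_def \<delta>_def by (intro exI[of _ "[0..<Suc (length w)]"]) (auto simp: nth_append)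
  qed
  have "\<delta> \<subseteq> {0..length w} \<times> \<Sigma> \<times> {0..length w}"
    using assms unfolding \<delta>_def by auto
  then show ?thesis
    unfolding regular_lang_def using assms accepts
    by (intro exI[of _ "{0..length w}"] exI[of _ 0] exI[of _ \<delta>] exI[of _ "{length w}"]) auto
qed

lemma cfg_step_from_terminal: "(map Inr r, y) \<notin> cfg_step P"
  unfolding cfg_step_def by (auto simp: map_eq_append_conv)

lemma cfg_step_one_nonterminal:
  assumes "(map Inr p @ Inl A # map Inr q, y) \<in> cfg_step P"
  shows "\<exists>rhs. (A, rhs) \<in> P \<and> y = map Inr p @ rhs @ map Inr q"
proof -
  obtain u v B rhs where uv: "map Inr p @ Inl A # map Inr q = u @ Inl B # v"
    and y: "y = u @ rhs @ v" and "(B, rhs) \<in> P"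
    using assms unfolding cfg_step_def by auto
  have "u = map Inr p \<and> B = A \<and> v = map Inr q"
    using uv
  proof (induction u arbitrary: p)
    case Nil
    then show ?case by (cases p) auto
  next
    case (Cons x u)
    then show ?case by (cases p) (auto simp: map_eq_append_conv)
  qed
  with y \<open>(B, rhs) \<in> P\<close> show ?thesis by blast
qed

lemma context_free_lang_singleton:
  assumes "set w \<subseteq> \<Sigma>"
  shows "context_free_lang \<Sigma> {w}"
proof -
  define P :: "(nat \<times> (nat + 'a) list) set" where "P = {(0, map Inr w)}"
  have step: "([Inl 0], map Inr w) \<in> cfg_step P"
    unfolding cfg_step_def P_def by force
  have derivable: "y \<in> {[Inl 0], map Inr w}" if "([Inl 0], y) \<in> (cfg_step P)\<^sup>*" for y
    using that
  proof (induction rule: rtrancl_induct)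
    case (step y z)
    then show ?case
      using cfg_step_one_nonterminal[of "[]" 0 "[]" z P] cfg_step_from_terminal[of w z P]
      unfolding P_def by auto
  qed simp
  have "([Inl 0], map Inr v) \<in> (cfg_step P)\<^sup>* \<longleftrightarrow> v = w" for v
    using step derivable[of "map Inr v"] by (auto simp: inj_map_eq_map)
  then show ?thesis
    unfolding context_free_lang_def using assms
    by (intro exI[of _ P] exI[of _ 0]) (auto simp: P_def)
qed

definition anbn_grammar :: "'a \<Rightarrow> 'a \<Rightarrow> (nat \<times> (nat + 'a) list) set" where
  "anbn_grammar a b = {(0, [Inr a, Inl 0, Inr b]), (0, [])}"

definition anbn_form :: "'a \<Rightarrow> 'a \<Rightarrow> nat \<Rightarrow> (nat + 'a) list" where
  "anbn_form a b n = map Inr (replicate n a) @ Inl 0 # map Inr (replicate n b)"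

lemma anbn_form_Suc:
  "anbn_form a b (Suc n) = map Inr (replicate n a) @ [Inr a, Inl 0, Inr b] @ map Inr (replicate n b)"
  unfolding anbn_form_def by (simp add: replicate_append_same[symmetric])

lemma anbn_grammar_derives_form: "([Inl 0], anbn_form a b n) \<in> (cfg_step (anbn_grammar a b))\<^sup>*"
proof (induction n)
  case 0
  show ?case by (simp add: anbn_form_def)
next
  case (Suc n)
  have "(anbn_form a b n, anbn_form a b (Suc n)) \<in> cfg_step (anbn_grammar a b)"
    unfolding cfg_step_def anbn_grammar_def anbn_form_Suc unfolding anbn_form_def
    by (rule CollectI, rule exI[of _ "map Inr (replicate n a)"], rule exI[of _ "map Inr (replicate n b)"],
        rule exI[of _ 0], rule exI[of _ "[Inr a, Inl 0, Inr b]"]) simp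
  with Suc show ?case by (rule rtrancl_into_rtrancl)
qed

lemma anbn_grammar_derives_word:
  "([Inl 0], map Inr (replicate n a @ replicate n b)) \<in> (cfg_step (anbn_grammar a b))\<^sup>*"
proof -
  have "(anbn_form a b n, map Inr (replicate n a @ replicate n b)) \<in> cfg_step (anbn_grammar a b)"
    unfolding cfg_step_def anbn_grammar_def anbn_form_def
    by (rule CollectI, rule exI[of _ "map Inr (replicate n a)"], rule exI[of _ "map Inr (replicate n b)"],
        rule exI[of _ 0], rule exI[of _ "[]"]) simp
  with anbn_grammar_derives_form show ?thesis by (rule rtrancl_into_rtrancl)
qed

lemma anbn_grammar_derivable:
  assumes "([Inl 0], y) \<in> (cfg_step (anbn_grammar a b))\<^sup>*"
  shows "y \<in> range (anbn_form a b) \<union> range (\<lambda>n. map Inr (replicate n a @ replicate n b))"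
  using assms
proof (induction rule: rtrancl_induct)
  case base
  show ?case by (auto simp: anbn_form_def intro: range_eqI[of _ _ 0])
next
  case (step y z)
  then obtain n where "y = anbn_form a b n"
    using cfg_step_from_terminal by blast
  then obtain rhs where "(0, rhs) \<in> anbn_grammar a b"
    and z: "z = map Inr (replicate n a) @ rhs @ map Inr (replicate n b)"
    using cfg_step_one_nonterminal step.hyps(2) unfolding anbn_form_def by blast
  then consider "rhs = [Inr a, Inl 0, Inr b]" | "rhs = []" unfolding anbn_grammar_def by auto
  then show ?case
  proof cases
    case 1
    then have "z = anbn_form a b (Suc n)" using z anbn_form_Suc[of a b n] by simp
    then show ?thesis by blast
  next
    case 2
    then show ?thesis using z by auto
  qed
qed

lemma context_free_lang_anbn:
  assumes "a \<in> \<Sigma>" "b \<in> \<Sigma>"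
  shows "context_free_lang \<Sigma> (range (\<lambda>n. replicate n a @ replicate n b))"
proof -
  have "([Inl 0], map Inr v) \<in> (cfg_step (anbn_grammar a b))\<^sup>* \<longleftrightarrow> (\<exists>n. v = replicate n a @ replicate n b)"
    for v
  proof
    assume "([Inl 0], map Inr v) \<in> (cfg_step (anbn_grammar a b))\<^sup>*"
    from anbn_grammar_derivable[OF this]
    have "map Inr v \<in> range (anbn_form a b) \<or> (\<exists>n. v = replicate n a @ replicate n b)"
      by (auto simp del: map_append map_replicate simp add: inj_map_eq_map)
    moreover have "map Inr v \<notin> range (anbn_form a b)"
    proof
      assume "map Inr v \<in> range (anbn_form a b)"
      then obtain n where n: "map Inr v = anbn_form a b n" by auto
      have "Inl (0::nat) \<in> set (map Inr v)" unfolding n by (simp add: anbn_form_def)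
      then show False by auto
    qed
    ultimately show "\<exists>n. v = replicate n a @ replicate n b" by blast
  next
    assume "\<exists>n. v = replicate n a @ replicate n b"
    then obtain n where "v = replicate n a @ replicate n b" by blast
    then show "([Inl 0], map Inr v) \<in> (cfg_step (anbn_grammar a b))\<^sup>*"
      using anbn_grammar_derives_word[of n a b] by simp
  qed
  then show ?thesis
    unfolding context_free_lang_def using assms
    by (intro exI[of _ "anbn_grammar a b"] exI[of _ 0]) (auto simp: anbn_grammar_def)
qed

lemma omega_pow_singleton: "omega_pow {[c]} = {\<lambda>_. c}"
proof
  show "omega_pow {[c]} \<subseteq> {\<lambda>_. c}"
  proof
    fix x assume "x \<in> omega_pow {[c]}"
    then have "x t = c" for t
    proof (induction t arbitrary: x)
      case 0
      then show ?case by (rule omega_powE) auto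
    next
      case (Suc t)
      from Suc.prems obtain x' where "x' \<in> omega_pow {[c]}" "x = [c] \<frown> x'"
        by (rule omega_powE) auto
      then show ?case using Suc.IH by simp
    qed
    then show "x \<in> {\<lambda>_. c}" by auto
  qed
  have "is_inf_concat (\<lambda>_. [c]) (\<lambda>_. c)"
    unfolding is_inf_concat_def by (simp add: subsequence_def map_replicate_const)
  then show "{\<lambda>_. c} \<subseteq> omega_pow {[c]}" unfolding omega_pow_def by auto
qed

lemma lang_conc_singleton: "lang_conc {u} W = (\<lambda>x. u \<frown> x) ` W"
  unfolding lang_conc_def by auto

definition example_RL :: "nat word set" where
  "example_RL = {\<lambda>_. 0, [1] \<frown> (\<lambda>_. 0)}"

definition example_CFL :: "nat word set" where
  "example_CFL = example_RL \<union> range (\<lambda>n. abc_word 2 3 4 n n)"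

lemma example_RL_in_omega_RL: "example_RL \<in> omega_RL"
proof -
  have "example_RL = (\<Union>(U, V) \<in> set [({[]}, {[0]}), ({[1]}, {[0]})]. lang_conc U (omega_pow V))"
    unfolding example_RL_def by (auto simp: lang_conc_singleton omega_pow_singleton)
  then show ?thesis
    unfolding omega_RL_def
    by (intro CollectI exI[of _ "{0, 1}"] exI[of _ "[({[]}, {[0]}), ({[1]}, {[0]})]"])
      (simp add: regular_lang_singleton)
qed

lemma example_CFL_in_omega_CFL: "example_CFL \<in> omega_CFL"
proof -
  let ?anbn = "range (\<lambda>n. replicate n 2 @ replicate n 3) :: nat list set"
  have "lang_conc ?anbn (omega_pow {[4]}) = range (\<lambda>n. abc_word 2 3 4 n n)"
    unfolding lang_conc_def omega_pow_singleton abc_word_def by auto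
  then have "example_CFL =
      (\<Union>(U, V) \<in> set [({[]}, {[0]}), ({[1]}, {[0]}), (?anbn, {[4]})]. lang_conc U (omega_pow V))"
    unfolding example_CFL_def example_RL_def by (auto simp: lang_conc_singleton omega_pow_singleton)
  then show ?thesis
    unfolding omega_CFL_def
    by (intro CollectI exI[of _ "{0, 1, 2, 3, 4}"] exI[of _ "[({[]}, {[0]}), ({[1]}, {[0]}), (?anbn, {[4]})]"])
      (simp add: context_free_lang_singleton context_free_lang_anbn)
qed

lemma example_CFL_no_switch: "replicate k 0 \<frown> (\<lambda>_. 1) \<notin> example_CFL"
proof -
  have "w (Suc k) \<noteq> 1" if "w \<in> example_CFL" for w
    using that unfolding example_CFL_def example_RL_def by (auto simp: abc_word_nth split: if_splits)
  then show ?thesis by force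
qed

lemma example_CFL_unbalanced:
  assumes "n < m"
  shows "abc_word 2 3 4 m n \<notin> example_CFL"
proof
  assume "abc_word 2 3 4 m n \<in> example_CFL"
  moreover have "abc_word 2 3 4 m n 0 = (2::nat)" using assms by (simp add: abc_word_nth)
  moreover have "abc_word 2 3 4 m n \<noteq> (abc_word 2 3 4 n' n' :: nat word)" for n'
  proof (cases "n' < m")
    case True
    then have "abc_word (2::nat) 3 4 m n n' \<noteq> abc_word 2 3 4 n' n' n'" by (simp add: abc_word_nth)
    then show ?thesis by metis
  next
    case False
    then have "abc_word (2::nat) 3 4 m n (m + n) \<noteq> abc_word 2 3 4 n' n' (m + n)"
      using assms by (simp add: abc_word_nth)
    then show ?thesis by metis
  qed
  ultimately show False unfolding example_CFL_def example_RL_def by auto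
qed

section \<open>A rotation automaton\<close>

definition rot :: "real \<Rightarrow> complex mat" where
  "rot \<phi> = mat 2 2 (\<lambda>(i, j). complex_of_real
     (if i = j then cos \<phi> else if i = 0 then - sin \<phi> else sin \<phi>))"

lemma rot_carrier [simp]: "rot \<phi> \<in> carrier_mat 2 2"
  unfolding rot_def by simp

lemma less_2_cases: "(i::nat) < 2 \<longleftrightarrow> i = 0 \<or> i = 1"
  by auto

lemma sum_upt_2: "(\<Sum>i::nat = 0..<2. f i) = f 0 + (f 1 :: 'a :: comm_monoid_add)"
  by (simp add: numeral_2_eq_2)

lemma rot_mult_vec:
  assumes "v \<in> carrier_vec 2"
  shows "rot \<phi> *\<^sub>v v = vec 2 (\<lambda>i. if i = 0
    then complex_of_real (cos \<phi>) * v $ 0 - complex_of_real (sin \<phi>) * v $ 1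
    else complex_of_real (sin \<phi>) * v $ 0 + complex_of_real (cos \<phi>) * v $ 1)"
  using assms by (intro eq_vecI) (auto simp: rot_def scalar_prod_def sum_upt_2 less_2_cases row_def)

lemma rot_add:
  assumes "v \<in> carrier_vec 2"
  shows "rot \<alpha> *\<^sub>v (rot \<beta> *\<^sub>v v) = rot (\<alpha> + \<beta>) *\<^sub>v v"
proof -
  have c: "rot \<beta> *\<^sub>v v \<in> carrier_vec 2" by (rule mult_mat_vec_carrier[OF rot_carrier assms])
  have i0: "(rot \<beta> *\<^sub>v v) $ 0 = complex_of_real (cos \<beta>) * v $ 0 - complex_of_real (sin \<beta>) * v $ 1"
    and i1: "(rot \<beta> *\<^sub>v v) $ 1 = complex_of_real (sin \<beta>) * v $ 0 + complex_of_real (cos \<beta>) * v $ 1"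
    by (simp_all add: rot_mult_vec[OF assms])
  show ?thesis
    unfolding rot_mult_vec[OF c, of \<alpha>] i0 i1 rot_mult_vec[OF assms, of "\<alpha> + \<beta>"]
    by (intro eq_vecI) (auto simp: cos_add sin_add algebra_simps)
qed

lemma rot_0: "v \<in> carrier_vec 2 \<Longrightarrow> rot 0 *\<^sub>v v = v"
  by (subst rot_mult_vec) (auto intro!: eq_vecI simp: less_2_cases)

lemma rot_unitary: "unitary_mat 2 (rot \<phi>)"
proof -
  have "mat_adjoint (rot \<phi>) * rot \<phi> = 1\<^sub>m 2" "rot \<phi> * mat_adjoint (rot \<phi>) = 1\<^sub>m 2"
    by (intro eq_matI;
        auto simp: scalar_prod_def sum_upt_2 less_2_cases mat_adjoint_entry mat_adjoint_def
          mat_of_rows_def rot_def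
          simp flip: of_real_mult of_real_add of_real_power power2_eq_square)+
  then show ?thesis unfolding unitary_mat_def by simp
qed

definition axis_line :: "complex vec set" where
  "axis_line = {v \<in> carrier_vec 2. v $ 1 = 0}"

lemma axis_line_unit_vec:
  assumes "v \<in> axis_line" "unit_vec_in 2 v"
  shows "cmod (v $ 0) = 1"
proof -
  have "(cmod (v $ 0))\<^sup>2 = 1"
    using unit_vec_sum_norm_sq[OF assms(2)] assms(1) unfolding axis_line_def
    by (simp add: numeral_2_eq_2)
  then show ?thesis using norm_ge_zero[of "v $ 0"] by (auto simp: power2_eq_1_iff)
qed

lemma rot_cscalar_prod_axis_line:
  assumes "v \<in> axis_line" "unit_vec_in 2 v" "\<psi> \<in> axis_line" "unit_vec_in 2 \<psi>"
  shows "(cmod ((rot \<phi> *\<^sub>v v) \<bullet>c \<psi>))\<^sup>2 = (cos \<phi>)\<^sup>2"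
proof -
  have "v \<in> carrier_vec 2" "v $ 1 = 0" "\<psi> \<in> carrier_vec 2" "\<psi> $ 1 = 0"
    using assms(1,3) unfolding axis_line_def by auto
  then have "(rot \<phi> *\<^sub>v v) \<bullet>c \<psi> = complex_of_real (cos \<phi>) * v $ 0 * cnj (\<psi> $ 0)"
    by (simp add: rot_mult_vec scalar_prod_def sum_upt_2)
  then show ?thesis
    using axis_line_unit_vec[OF assms(1,2)] axis_line_unit_vec[OF assms(3,4)] by (simp add: norm_mult)
qed

definition rot_automaton :: "real \<Rightarrow> (nat \<Rightarrow> int) \<Rightarrow> nat \<Rightarrow> complex mat" where
  "rot_automaton \<theta> g x = rot (\<theta> * of_int (g x))"

definition balance :: "(nat \<Rightarrow> int) \<Rightarrow> nat word \<Rightarrow> nat \<Rightarrow> int" where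
  "balance g w n = (\<Sum>t<n. g (w t))"

definition checkpoint_gain :: "(nat \<Rightarrow> int) \<Rightarrow> nat word \<Rightarrow> (nat \<Rightarrow> nat) \<Rightarrow> nat \<Rightarrow> int" where
  "checkpoint_gain g w N i = balance g w (N i) - (case i of 0 \<Rightarrow> 0 | Suc j \<Rightarrow> balance g w (N j))"

lemma balance_Suc: "balance g w (Suc n) = balance g w n + g (w n)"
  unfolding balance_def by simp

lemma rot_automaton_run_segment:
  assumes "\<forall>t. m \<le> t \<and> t < m + k \<longrightarrow> t \<notin> range N"
    and "disturbing_run (rot_automaton \<theta> g) s0 \<psi> N w m \<in> carrier_vec 2"
  shows "disturbing_run (rot_automaton \<theta> g) s0 \<psi> N w (m + k) =
    rot (\<theta> * of_int (balance g w (m + k) - balance g w m)) *\<^sub>v disturbing_run (rot_automaton \<theta> g) s0 \<psi> N w m"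
  using assms(1)
proof (induction k)
  case 0
  then show ?case using rot_0[OF assms(2)] by simp
next
  case (Suc k)
  let ?run = "disturbing_run (rot_automaton \<theta> g) s0 \<psi> N w"
  have "m + k \<notin> range N" using Suc.prems by simp
  then have "?run (m + Suc k) = rot (\<theta> * of_int (g (w (m + k)))) *\<^sub>v ?run (m + k)"
    by (simp add: rot_automaton_def)
  also have "\<dots> = rot (\<theta> * of_int (g (w (m + k)))) *\<^sub>v
      (rot (\<theta> * of_int (balance g w (m + k) - balance g w m)) *\<^sub>v ?run m)"
    using Suc by simp
  also have "\<dots> = rot (\<theta> * of_int (balance g w (m + Suc k) - balance g w m)) *\<^sub>v ?run m"
    unfolding rot_add[OF assms(2)] by (simp add: balance_Suc algebra_simps)
  finally show ?case .
qed

lemma rot_automaton_run_at_checkpoint: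
  assumes N: "checkpoints N" and "s0 \<in> carrier_vec 2" "\<psi> \<in> carrier_vec 2"
  shows "disturbing_run (rot_automaton \<theta> g) s0 \<psi> N w (N i) =
    rot (\<theta> * of_int (checkpoint_gain g w N i)) *\<^sub>v (if i = 0 then s0 else \<psi>)"
proof (cases i)
  case 0
  have "\<forall>t. 0 \<le> t \<and> t < 0 + N 0 \<longrightarrow> t \<notin> range N"
    using N unfolding checkpoints_def by (auto simp: strict_mono_less_eq not_le[symmetric])
  from rot_automaton_run_segment[OF this] show ?thesis
    using assms(2) 0 by (simp add: checkpoint_gain_def balance_def)
next
  case (Suc j)
  define m where "m = Suc (N j)"
  have "N j < N (Suc j)" using N unfolding checkpoints_def strict_mono_def by simp
  then have m: "m + (N (Suc j) - m) = N (Suc j)" unfolding m_def by simp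
  have "t \<notin> range N" if "m \<le> t" "t < N (Suc j)" for t
  proof
    assume "t \<in> range N"
    then obtain l where "t = N l" by auto
    with that have "N j < N l" "N l < N (Suc j)" unfolding m_def by auto
    then have "j < l" "l < Suc j" using N unfolding checkpoints_def by (auto dest: strict_mono_less)
    then show False by simp
  qed
  then have "\<forall>t. m \<le> t \<and> t < m + (N (Suc j) - m) \<longrightarrow> t \<notin> range N" using m by simp
  moreover have start: "disturbing_run (rot_automaton \<theta> g) s0 \<psi> N w m = rot (\<theta> * of_int (g (w (N j)))) *\<^sub>v \<psi>"
    unfolding m_def by (simp add: rot_automaton_def)
  moreover have "disturbing_run (rot_automaton \<theta> g) s0 \<psi> N w m \<in> carrier_vec 2"
    unfolding start by (rule mult_mat_vec_carrier[OF rot_carrier assms(3)])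
  ultimately have "disturbing_run (rot_automaton \<theta> g) s0 \<psi> N w (N (Suc j)) =
      rot (\<theta> * of_int (balance g w (N (Suc j)) - balance g w m)) *\<^sub>v
      (rot (\<theta> * of_int (g (w (N j)))) *\<^sub>v \<psi>)"
    using rot_automaton_run_segment[of m "N (Suc j) - m" N \<theta> g s0 \<psi> w] unfolding m by simp
  also have "\<dots> = rot (\<theta> * of_int (checkpoint_gain g w N (Suc j))) *\<^sub>v \<psi>"
    unfolding rot_add[OF assms(3)] by (simp add: checkpoint_gain_def m_def balance_Suc algebra_simps)
  finally show ?thesis using Suc by simp
qed

lemma rot_automaton_run_value:
  assumes "\<psi> \<in> axis_line" "unit_vec_in 2 \<psi>" "checkpoints N"
  shows "run_value (rot_automaton \<theta> g) (unit_vec 2 0) \<psi> N w =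
    (INF i. (cos (\<theta> * of_int (checkpoint_gain g w N i)))\<^sup>2)"
proof -
  have e: "unit_vec 2 0 \<in> axis_line" "unit_vec_in 2 (unit_vec 2 0)"
    unfolding axis_line_def unit_vec_in_def by (auto simp: scalar_prod_def sum_upt_2)
  have "\<psi> \<in> carrier_vec 2" using assms(1) unfolding axis_line_def by simp
  note run = rot_automaton_run_at_checkpoint[OF assms(3) unit_vec_carrier this, where \<theta> = \<theta> and g = g and w = w]
  have "(cmod (disturbing_run (rot_automaton \<theta> g) (unit_vec 2 0) \<psi> N w (N i) \<bullet>c \<psi>))\<^sup>2 =
      (cos (\<theta> * of_int (checkpoint_gain g w N i)))\<^sup>2" for i
    unfolding run
    using rot_cscalar_prod_axis_line[OF e assms(1,2)] rot_cscalar_prod_axis_line[OF assms(1,2) assms(1,2)]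
    by simp
  then show ?thesis unfolding run_value_def by simp
qed

lemma unit_vec_0_axis_line: "unit_vec 2 0 \<in> axis_line" "unit_vec_in 2 (unit_vec 2 0)"
  unfolding axis_line_def unit_vec_in_def by (auto simp: scalar_prod_def sum_upt_2)

lemma rot_automaton_unitary: "unitary_mat 2 (rot_automaton \<theta> g x)"
  unfolding rot_automaton_def by (rule rot_unitary)

lemma rot_automaton_quantum_automaton:
  "finite \<Sigma> \<Longrightarrow> \<Sigma> \<noteq> {} \<Longrightarrow> quantum_automaton 2 (unit_vec 2 0) \<Sigma> (rot_automaton \<theta> g) axis_line"
  unfolding quantum_automaton_def is_subspace_def axis_line_def
  using unit_vec_0_axis_line rot_automaton_unitary by (auto simp: axis_line_def)

lemma rot_automaton_fD_le:
  assumes "\<And>\<psi> N. \<psi> \<in> axis_line \<Longrightarrow> unit_vec_in 2 \<psi> \<Longrightarrow> checkpoints N \<Longrightarrow>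
      (\<exists>i. (cos (\<theta> * of_int (checkpoint_gain g w N i)))\<^sup>2 \<le> C)"
    and "0 \<le> C"
  shows "fD 2 (unit_vec 2 0) (rot_automaton \<theta> g) axis_line w \<le> C"
proof (rule fD_le[OF _ \<open>0 \<le> C\<close>])
  fix \<psi> N assume \<psi>: "\<psi> \<in> axis_line" "unit_vec_in 2 \<psi>" and N: "checkpoints N"
  then obtain i where "(cos (\<theta> * of_int (checkpoint_gain g w N i)))\<^sup>2 \<le> C" using assms(1) by blast
  moreover have "run_value (rot_automaton \<theta> g) (unit_vec 2 0) \<psi> N w \<le>
      (cos (\<theta> * of_int (checkpoint_gain g w N i)))\<^sup>2"
    unfolding rot_automaton_run_value[OF \<psi> N] by (rule cINF_lower) (auto intro: bdd_belowI[of _ 0])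
  ultimately show "run_value (rot_automaton \<theta> g) (unit_vec 2 0) \<psi> N w \<le> C" by linarith
qed

lemma rot_automaton_fD_eq_1:
  assumes "\<forall>t\<ge>T. balance g w t = 0"
  shows "fD 2 (unit_vec 2 0) (rot_automaton \<theta> g) axis_line w = 1"
proof (rule antisym)
  show "fD 2 (unit_vec 2 0) (rot_automaton \<theta> g) axis_line w \<le> 1"
    by (rule rot_automaton_fD_le) (auto simp: abs_square_le_1)
  define N where "N i = T + i" for i
  have N: "checkpoints N" unfolding checkpoints_def strict_mono_def N_def by simp
  have "checkpoint_gain g w N i = 0" for i
    using assms unfolding checkpoint_gain_def N_def by (simp split: nat.split)
  then have "1 = run_value (rot_automaton \<theta> g) (unit_vec 2 0) (unit_vec 2 0) N w"
    by (simp add: rot_automaton_run_value[OF unit_vec_0_axis_line N])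
  also have "\<dots> \<le> fD 2 (unit_vec 2 0) (rot_automaton \<theta> g) axis_line w"
    by (rule fD_ge[OF unit_vec_0_axis_line(2) rot_automaton_unitary unit_vec_0_axis_line N])
  finally show "1 \<le> fD 2 (unit_vec 2 0) (rot_automaton \<theta> g) axis_line w" .
qed

lemma balance_zero_if_gains_zero:
  assumes "\<And>i. checkpoint_gain g w N i = 0"
  shows "balance g w (N i) = 0"
proof (induction i)
  case 0
  then show ?case using assms[of 0] by (simp add: checkpoint_gain_def)
next
  case (Suc i)
  then show ?case using assms[of "Suc i"] by (simp add: checkpoint_gain_def)
qed

lemma checkpoint_gain_bound:
  assumes "\<And>t. \<bar>balance g w t\<bar> \<le> M"
  shows "\<bar>checkpoint_gain g w N i\<bar> \<le> 2 * M"
proof (cases i)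
  case 0
  then show ?thesis using assms[of "N 0"] assms[of 0] by (simp add: checkpoint_gain_def)
next
  case (Suc j)
  then show ?thesis using assms[of "N i"] assms[of "N j"] by (simp add: checkpoint_gain_def)
qed

text \<open>Some checkpoint gain is a nonzero integer of absolute value at most \<open>2 M\<close>, and each of these
  finitely many integers costs a fixed amount.\<close>
lemma rot_automaton_fD_lt_1:
  assumes \<theta>: "\<And>k::int. k \<noteq> 0 \<Longrightarrow> sin (\<theta> * of_int k) \<noteq> 0"
    and bounded: "\<And>t. \<bar>balance g w t\<bar> \<le> M"
    and eventually: "\<forall>t\<ge>T. balance g w t = c" and "c \<noteq> 0"
  shows "fD 2 (unit_vec 2 0) (rot_automaton \<theta> g) axis_line w < 1"
proof -
  define K where "K = {-2 * M..2 * M} - {0}"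
  define C where "C = Max ((\<lambda>k. (cos (\<theta> * of_int k))\<^sup>2) ` K)"
  have "c \<in> K" using bounded[of T] eventually \<open>c \<noteq> 0\<close> unfolding K_def by auto
  then have "C \<in> (\<lambda>k. (cos (\<theta> * of_int k))\<^sup>2) ` K" unfolding C_def K_def by (intro Max_in) auto
  then obtain k where "k \<in> K" and C: "C = (cos (\<theta> * of_int k))\<^sup>2" by blast
  have "(sin (\<theta> * of_int k))\<^sup>2 > 0" using \<theta> \<open>k \<in> K\<close> unfolding K_def by simp
  then have "C < 1" using sin_cos_squared_add[of "\<theta> * of_int k"] unfolding C by linarith
  have "fD 2 (unit_vec 2 0) (rot_automaton \<theta> g) axis_line w \<le> C"
  proof (rule rot_automaton_fD_le)
    fix \<psi> N assume "checkpoints N"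
    have "\<exists>i. checkpoint_gain g w N i \<noteq> 0"
    proof (rule ccontr)
      assume "\<nexists>i. checkpoint_gain g w N i \<noteq> 0"
      then have "balance g w (N T) = 0" by (intro balance_zero_if_gains_zero) blast
      moreover have "N T \<ge> T"
        using \<open>checkpoints N\<close> unfolding checkpoints_def by (rule strict_mono_imp_increasing)
      ultimately show False using eventually \<open>c \<noteq> 0\<close> by simp
    qed
    then obtain i where "checkpoint_gain g w N i \<noteq> 0" by blast
    moreover have "\<bar>checkpoint_gain g w N i\<bar> \<le> 2 * M" by (rule checkpoint_gain_bound[OF bounded])
    ultimately have "checkpoint_gain g w N i \<in> K" unfolding K_def by auto
    then show "\<exists>i. (cos (\<theta> * of_int (checkpoint_gain g w N i)))\<^sup>2 \<le> C"
      unfolding C_def K_def by (intro exI[of _ i] Max_ge) auto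
  next
    show "0 \<le> C" unfolding C by simp
  qed
  with \<open>C < 1\<close> show ?thesis by linarith
qed

text \<open>The coordinates of \<open>(3 + 4 \<i>)\<^sup>k\<close>.\<close>
fun pythagorean_power :: "nat \<Rightarrow> int \<times> int" where
  "pythagorean_power 0 = (1, 0)"
| "pythagorean_power (Suc k) =
    (3 * fst (pythagorean_power k) - 4 * snd (pythagorean_power k),
     4 * fst (pythagorean_power k) + 3 * snd (pythagorean_power k))"

lemma cos_sin_mult_arccos_3_5:
  "cos (real k * arccos (3/5)) = fst (pythagorean_power k) / 5 ^ k \<and>
   sin (real k * arccos (3/5)) = snd (pythagorean_power k) / 5 ^ k"
proof (induction k)
  case (Suc k)
  have "sin (arccos (3/5)) = sqrt (1 - (3/5)\<^sup>2)" by (rule sin_arccos) auto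
  also have "\<dots> = 4/5" by (rule real_sqrt_unique) (auto simp: power2_eq_square)
  finally have sin: "sin (arccos (3/5)) = 4/5" .
  have split: "real (Suc k) * arccos (3/5) = real k * arccos (3/5) + arccos (3/5)"
    by (simp add: algebra_simps)
  show ?case unfolding split cos_add sin_add using Suc by (simp add: sin field_simps)
qed simp

lemma pythagorean_power_mod_5: "k \<ge> 1 \<Longrightarrow> \<exists>a b. pythagorean_power k = (5 * a + 3, 5 * b + 4)"
proof (induction k)
  case (Suc k)
  show ?case
  proof (cases "k = 0")
    case False
    then obtain a b where "pythagorean_power k = (5 * a + 3, 5 * b + 4)" using Suc by auto
    then show ?thesis
      by (intro exI[of _ "3 * a - 4 * b - 2"] exI[of _ "4 * a + 3 * b + 4"]) (simp add: algebra_simps)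
  qed (intro exI[of _ 0]; simp)
qed simp

lemma sin_mult_arccos_3_5_neq_0:
  assumes "(k::int) \<noteq> 0"
  shows "sin (arccos (3/5) * of_int k) \<noteq> 0"
proof -
  have "nat \<bar>k\<bar> \<ge> 1" using assms by simp
  then obtain a b where "pythagorean_power (nat \<bar>k\<bar>) = (5 * a + 3, 5 * b + 4)"
    using pythagorean_power_mod_5 by blast
  moreover have "5 * b + 4 \<noteq> 0" by presburger
  ultimately have "sin (real (nat \<bar>k\<bar>) * arccos (3/5)) \<noteq> 0"
    using cos_sin_mult_arccos_3_5[of "nat \<bar>k\<bar>"] by simp
  then show ?thesis by (cases "k \<ge> 0") (simp_all add: mult.commute)
qed

definition counter_weight :: "nat \<Rightarrow> int" where
  "counter_weight x = (if x = 0 then 1 else if x = 1 then -1 else 0)"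

lemma balance_counter_abc_word:
  "balance counter_weight (abc_word 0 1 2 m n) t = int (min t m) - int (min (t - m) n)"
proof (induction t)
  case (Suc t)
  then show ?case by (simp add: balance_Suc abc_word_nth counter_weight_def)
qed (simp add: balance_def)

definition example_QBA :: "nat word set" where
  "example_QBA = lang_eq1 2 (unit_vec 2 0) {0, 1, 2} (rot_automaton (arccos (3/5)) counter_weight) axis_line"

lemma example_QBA_in_QBA_D_eq1: "example_QBA \<in> QBA_D_eq1"
  unfolding QBA_D_eq1_def example_QBA_def
  using rot_automaton_quantum_automaton[of "{0, 1, 2}" "arccos (3/5)" counter_weight] by blast

lemma example_QBA_balanced: "abc_word 0 1 2 n n \<in> example_QBA"
proof -
  have "\<forall>t\<ge>2 * n. balance counter_weight (abc_word 0 1 2 n n) t = 0"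
    unfolding balance_counter_abc_word by simp
  then have "fD 2 (unit_vec 2 0) (rot_automaton (arccos (3/5)) counter_weight) axis_line
      (abc_word 0 1 2 n n) = 1"
    by (rule rot_automaton_fD_eq_1)
  then show ?thesis unfolding example_QBA_def lang_eq1_def using abc_word_range by simp
qed

lemma example_QBA_unbalanced:
  assumes "n < m"
  shows "abc_word 0 1 2 m n \<notin> example_QBA"
proof -
  have bounded: "\<bar>balance counter_weight (abc_word 0 1 2 m n) t\<bar> \<le> int (m + n)" for t
    unfolding balance_counter_abc_word by simp
  have eventually: "\<forall>t\<ge>m + n. balance counter_weight (abc_word 0 1 2 m n) t = int m - int n"
    unfolding balance_counter_abc_word by simp
  have "int m - int n \<noteq> 0" using assms by simp
  note rot_automaton_fD_lt_1[OF sin_mult_arccos_3_5_neq_0 bounded eventually this]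
  then show ?thesis unfolding example_QBA_def lang_eq1_def by simp
qed

lemma example_CFL_subsets_not_QBA_D_gt:
  assumes "0 \<le> lam" "lam < 1" "example_RL \<subseteq> L" "L \<subseteq> example_CFL"
  shows "L \<notin> QBA_D_gt lam"
proof
  assume "L \<in> QBA_D_gt lam"
  moreover have "(\<lambda>_. 0) \<in> L" "[1] \<frown> (\<lambda>_. 0) \<in> L" using assms(3) unfolding example_RL_def by auto
  ultimately obtain k where "replicate k 0 \<frown> (\<lambda>_. 1) \<in> L"
    using QBA_D_gt_switch[OF _ assms(1,2), of L 0 "[1] \<frown> (\<lambda>_. 0)" 1] by auto
  with assms(4) example_CFL_no_switch show False by blast
qed

lemma example_CFL_not_omega_RL: "example_CFL \<notin> omega_RL"
  using example_CFL_unbalanced by (intro abc_not_omega_RL[of 2 3 4]) (auto simp: example_CFL_def)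

lemma example_QBA_not_omega_RL: "example_QBA \<notin> omega_RL"
  using example_QBA_balanced example_QBA_unbalanced by (intro abc_not_omega_RL)

theorem theorem9:
  shows "(\<forall>lam::real. 0 \<le> lam \<and> lam < 1 \<longrightarrow> \<not> omega_RL \<subseteq> QBA_D_gt lam)
       \<and> (\<forall>lam::real. 0 \<le> lam \<and> lam < 1 \<longrightarrow> \<not> (omega_CFL - omega_RL) \<subseteq> QBA_D_gt lam)
       \<and> \<not> QBA_D_eq1 \<subseteq> omega_RL"
proof (intro conjI allI impI)
  fix lam :: real
  assume lam: "0 \<le> lam \<and> lam < 1"
  have "example_RL \<subseteq> example_CFL" unfolding example_CFL_def by blast
  then have "example_RL \<notin> QBA_D_gt lam" "example_CFL \<notin> QBA_D_gt lam"
    using lam by (simp_all add: example_CFL_subsets_not_QBA_D_gt)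
  then show "\<not> omega_RL \<subseteq> QBA_D_gt lam" "\<not> (omega_CFL - omega_RL) \<subseteq> QBA_D_gt lam"
    using example_RL_in_omega_RL example_CFL_in_omega_CFL example_CFL_not_omega_RL by blast+
next
  show "\<not> QBA_D_eq1 \<subseteq> omega_RL"
    using example_QBA_in_QBA_D_eq1 example_QBA_not_omega_RL by blast
qed

end
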